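(* Let $\alpha,\beta,\gamma$ be non-negative integers, let $\mathfrak p\in B_\infty[\alpha]\backslash B_\infty/B_\infty[\beta]$ and $\mathfrak q\in B_\infty[\beta]\backslash B_\infty/B_\infty[\gamma]$, and let $p\in\mathfrak p$, $q\in\mathfrak q$ be representatives. Then the double coset $B_\infty[\alpha]\,p\,\theta_n[\beta]\,q\,B_\infty[\gamma]$ is the same for all sufficiently large $n$, and this eventual value does not depend on the choice of the representatives $p\in\mathfrak p$ and $q\in\mathfrak q$. Hence $$\mathfrak p\circ\mathfrak q = B_\infty[\alpha]\,p\,\theta_n[\beta]\,q\,B_\infty[\gamma]\quad (n \text{ sufficiently large})$$ is a well-defined element of $B_\infty[\alpha]\backslash B_\infty/B_\infty[\gamma]$. Moreover, this operation is associative: for all non-negative integers $\alpha,\beta,\gamma,\delta$ and all $\mathfrak a\in B_\infty[\alpha]\backslash B_\infty/B_\infty[\beta]$, $\mathfrak b\in B_\infty[\beta]\backslash B_\infty/B_\infty[\gamma]$, $\mathfrak c\in B_\infty[\gamma]\backslash B_\infty/B_\infty[\delta]$, one has $(\mathfrak a\circ\mathfrak b)\circ\mathfrak c=\mathfrak a\circ(\mathfrak b\circ\mathfrak c)$.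
   Context: $B_\infty$ is the infinite braid group, with generators $\sigma_i$ ($i\ge 1$) and relations $\sigma_i\sigma_j=\sigma_j\sigma_i$ for $|i-j|\ge 2$ and $\sigma_i\sigma_{i+1}\sigma_i=\sigma_{i+1}\sigma_i\sigma_{i+1}$ for $i\geq 1$; it is the direct limit of the Artin braid groups $B_n=\langle\sigma_1,\dots,\sigma_{n-1}\rangle$ under the inclusions $B_n\to B_{n+1}$, $\sigma_k\mapsto\sigma_k$. For a non-negative integer $\alpha$, $B_\infty[\alpha]=\langle \sigma_j \mid j>\alpha\rangle$. For subgroups $K,L$ of a group $G$, $K\backslash G/L$ denotes the set of double cosets $KgL$, $g\in G$. For integers $\beta\ge 0$ and $n>0$, put $\tau_i^{(n)}=\sigma_{n+\beta+i}\sigma_{n+\beta+i-1}\cdots\sigma_{\beta+i+1}$ (indices decreasing by one from $n+\beta+i$ to $\beta+i+1$), and $\theta_n[\beta]=\tau_0^{(n)}\tau_1^{(n)}\cdots\tau_{n-1}^{(n)}\in B_\infty[\beta]$. *)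

theory Defs
  imports "HOL-Algebra.Generated_Groups"
begin

text \<open>
  A letter (True, i) stands for the generator with index i, and (False, i) for its formal
  inverse; generators are indexed by the positive natural numbers.
\<close>

type_synonym braid_word = "(bool \<times> nat) list"

definition braid_words :: "braid_word set"
  where "braid_words = lists {(e, i). i \<ge> 1}"

text \<open>
  The congruence on words generated by free cancellation and the braid relations; its quotient is
  the group with this presentation, namely the infinite braid group.
\<close>

inductive_set braid_rel :: "(braid_word \<times> braid_word) set"
  where
    refl: "w \<in> braid_words \<Longrightarrow> (w, w) \<in> braid_rel"
  | sym: "(u, v) \<in> braid_rel \<Longrightarrow> (v, u) \<in> braid_rel"
  | trans: "(u, v) \<in> braid_rel \<Longrightarrow> (v, w) \<in> braid_rel \<Longrightarrow> (u, w) \<in> braid_rel"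
  | ctxt: "(u, v) \<in> braid_rel \<Longrightarrow> a \<in> braid_words \<Longrightarrow> b \<in> braid_words
            \<Longrightarrow> (a @ u @ b, a @ v @ b) \<in> braid_rel"
  | cancel: "i \<ge> 1 \<Longrightarrow> ([(e, i), (\<not> e, i)], []) \<in> braid_rel"
  | far: "i \<ge> 1 \<Longrightarrow> i + 2 \<le> j \<Longrightarrow>
            ([(True, i), (True, j)], [(True, j), (True, i)]) \<in> braid_rel"
  | braid: "i \<ge> 1 \<Longrightarrow>
            ([(True, i), (True, i + 1), (True, i)],
             [(True, i + 1), (True, i), (True, i + 1)]) \<in> braid_rel"

type_synonym braid = "braid_word set"

definition braid_group :: "braid monoid"  (\<open>B\<^sub>\<infinity>\<close>)
  where "B\<^sub>\<infinity> = \<lparr>carrier = braid_words // braid_rel,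
                mult = (\<lambda>x y. \<Union>u\<in>x. \<Union>v\<in>y. braid_rel `` {u @ v}),
                one = braid_rel `` {[]}\<rparr>"

definition \<sigma> :: "nat \<Rightarrow> braid"
  where "\<sigma> i = braid_rel `` {[(True, i)]}"

lemma append_in_braid_words:
  "u \<in> braid_words \<Longrightarrow> v \<in> braid_words \<Longrightarrow> u @ v \<in> braid_words"
  by (simp add: braid_words_def)

lemma braid_rel_in_words:
  assumes "(u, v) \<in> braid_rel"
  shows "u \<in> braid_words \<and> v \<in> braid_words"
  using assms by induction (auto simp: braid_words_def)

lemma equiv_braid_rel: "equiv braid_words braid_rel"
proof (rule equivI)
  show "refl_on braid_words braid_rel"
    by (rule refl_onI) (rule braid_rel.refl)
  show "sym braid_rel"
    by (rule symI) (rule braid_rel.sym)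
  show "trans braid_rel"
    by (rule transI) (rule braid_rel.trans)
  show "braid_rel \<subseteq> braid_words \<times> braid_words"
    using braid_rel_in_words by auto
qed

lemma braid_rel_append:
  assumes "(u, u') \<in> braid_rel" "(v, v') \<in> braid_rel"
  shows "(u @ v, u' @ v') \<in> braid_rel"
proof -
  have w: "u \<in> braid_words" "u' \<in> braid_words" "v \<in> braid_words" "v' \<in> braid_words"
    "[] \<in> braid_words"
    using assms braid_rel_in_words by (auto simp: braid_words_def)
  have "(u @ v, u' @ v) \<in> braid_rel"
    using braid_rel.ctxt[OF assms(1) w(5) w(3)] by simp
  moreover have "(u' @ v, u' @ v') \<in> braid_rel"
    using braid_rel.ctxt[OF assms(2) w(2) w(5)] by simp
  ultimately show ?thesis by (rule braid_rel.trans)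
qed

lemma braid_mult_class:
  assumes "u \<in> braid_words" "v \<in> braid_words"
  shows "braid_rel `` {u} \<otimes>\<^bsub>B\<^sub>\<infinity>\<^esub> braid_rel `` {v} = braid_rel `` {u @ v}"
proof -
  have eq: "braid_rel `` {a @ b} = braid_rel `` {u @ v}"
    if "(u, a) \<in> braid_rel" "(v, b) \<in> braid_rel" for a b
    using equiv_class_eq[OF equiv_braid_rel braid_rel_append[OF that]] by simp
  have r: "(u, u) \<in> braid_rel" "(v, v) \<in> braid_rel"
    using assms braid_rel.refl by auto
  have "braid_rel `` {u} \<otimes>\<^bsub>B\<^sub>\<infinity>\<^esub> braid_rel `` {v}
      = (\<Union>a\<in>braid_rel `` {u}. \<Union>b\<in>braid_rel `` {v}. braid_rel `` {a @ b})"
    by (simp add: braid_group_def)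
  also have "\<dots> = (\<Union>a\<in>braid_rel `` {u}. \<Union>b\<in>braid_rel `` {v}. braid_rel `` {u @ v})"
    using eq by (intro SUP_cong HOL.refl) (simp only: Image_singleton_iff)
  also have "\<dots> = braid_rel `` {u @ v}"
    using r by (simp only: UN_constant) auto
  finally show ?thesis .
qed

lemma carrier_braid_group: "carrier B\<^sub>\<infinity> = braid_words // braid_rel"
  by (simp add: braid_group_def)

lemma one_braid_group: "\<one>\<^bsub>B\<^sub>\<infinity>\<^esub> = braid_rel `` {[]}"
  by (simp add: braid_group_def)

lemma braid_word_inverse:
  assumes "w \<in> braid_words"
  shows "\<exists>w'\<in>braid_words. (w' @ w, []) \<in> braid_rel"
  using assms
proof (induction w)
  case Nil
  then show ?case using braid_rel.refl by (intro bexI[of _ "[]"]) auto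
next
  case (Cons x w)
  obtain e i where x: "x = (e, i)" by (cases x)
  have i: "i \<ge> 1" and w: "w \<in> braid_words"
    using Cons.prems x by (auto simp: braid_words_def)
  obtain w' where w': "w' \<in> braid_words" "(w' @ w, []) \<in> braid_rel"
    using Cons.IH w by blast
  have "([(\<not> e, i), (e, i)], []) \<in> braid_rel"
    using braid_rel.cancel[OF i, of "\<not> e"] by simp
  from braid_rel.ctxt[OF this w'(1) w]
  have "((w' @ [(\<not> e, i)]) @ x # w, w' @ w) \<in> braid_rel"
    using x by simp
  then have "((w' @ [(\<not> e, i)]) @ x # w, []) \<in> braid_rel"
    using w'(2) by (rule braid_rel.trans)
  moreover have "w' @ [(\<not> e, i)] \<in> braid_words"
    using w' i by (auto simp: braid_words_def)
  ultimately show ?case by blast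
qed

lemma group_braid_group: "group B\<^sub>\<infinity>"
proof (rule groupI)
  have nil: "[] \<in> braid_words" by (simp add: braid_words_def)
  show "\<one>\<^bsub>B\<^sub>\<infinity>\<^esub> \<in> carrier B\<^sub>\<infinity>"
    using nil by (auto simp: one_braid_group carrier_braid_group intro: quotientI)
  fix x assume "x \<in> carrier B\<^sub>\<infinity>"
  then obtain u where u: "u \<in> braid_words" "x = braid_rel `` {u}"
    by (auto simp: carrier_braid_group elim: quotientE)
  show "\<one>\<^bsub>B\<^sub>\<infinity>\<^esub> \<otimes>\<^bsub>B\<^sub>\<infinity>\<^esub> x = x"
    using u nil by (simp add: one_braid_group braid_mult_class)
  show "\<exists>y\<in>carrier B\<^sub>\<infinity>. y \<otimes>\<^bsub>B\<^sub>\<infinity>\<^esub> x = \<one>\<^bsub>B\<^sub>\<infinity>\<^esub>"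
  proof -
    obtain u' where u': "u' \<in> braid_words" "(u' @ u, []) \<in> braid_rel"
      using braid_word_inverse u(1) by blast
    have "braid_rel `` {u'} \<in> carrier B\<^sub>\<infinity>"
      using u' by (auto simp: carrier_braid_group intro: quotientI)
    moreover have "braid_rel `` {u'} \<otimes>\<^bsub>B\<^sub>\<infinity>\<^esub> x = \<one>\<^bsub>B\<^sub>\<infinity>\<^esub>"
      using u u' equiv_class_eq[OF equiv_braid_rel u'(2)]
      by (simp add: one_braid_group braid_mult_class)
    ultimately show ?thesis by blast
  qed
  fix y assume "y \<in> carrier B\<^sub>\<infinity>"
  then obtain v where v: "v \<in> braid_words" "y = braid_rel `` {v}"
    by (auto simp: carrier_braid_group elim: quotientE)
  show "x \<otimes>\<^bsub>B\<^sub>\<infinity>\<^esub> y \<in> carrier B\<^sub>\<infinity>"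
    using u v append_in_braid_words[of u v]
    by (auto simp: braid_mult_class carrier_braid_group intro: quotientI)
  fix z assume "z \<in> carrier B\<^sub>\<infinity>"
  then obtain w where w: "w \<in> braid_words" "z = braid_rel `` {w}"
    by (auto simp: carrier_braid_group elim: quotientE)
  show "x \<otimes>\<^bsub>B\<^sub>\<infinity>\<^esub> y \<otimes>\<^bsub>B\<^sub>\<infinity>\<^esub> z = x \<otimes>\<^bsub>B\<^sub>\<infinity>\<^esub> (y \<otimes>\<^bsub>B\<^sub>\<infinity>\<^esub> z)"
    using u v w append_in_braid_words by (simp add: braid_mult_class)
qed

definition braid_tail :: "nat \<Rightarrow> braid set"  (\<open>B\<^sub>\<infinity>[_]\<close>)
  where "B\<^sub>\<infinity>[\<alpha>] = generate B\<^sub>\<infinity> {\<sigma> j |j. j > \<alpha>}"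

definition double_coset :: "nat \<Rightarrow> braid \<Rightarrow> nat \<Rightarrow> braid set"
  where "double_coset \<alpha> g \<beta> = (B\<^sub>\<infinity>[\<alpha>] #>\<^bsub>B\<^sub>\<infinity>\<^esub> g) <#>\<^bsub>B\<^sub>\<infinity>\<^esub> B\<^sub>\<infinity>[\<beta>]"

definition double_cosets :: "nat \<Rightarrow> nat \<Rightarrow> braid set set"
  where "double_cosets \<alpha> \<beta> = {double_coset \<alpha> g \<beta> |g. g \<in> carrier B\<^sub>\<infinity>}"

definition list_prod :: "braid list \<Rightarrow> braid"
  where "list_prod xs = foldr (\<lambda>x y. x \<otimes>\<^bsub>B\<^sub>\<infinity>\<^esub> y) xs \<one>\<^bsub>B\<^sub>\<infinity>\<^esub>"

definition \<tau> :: "nat \<Rightarrow> nat \<Rightarrow> nat \<Rightarrow> braid"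
  where "\<tau> \<beta> n i = list_prod (map \<sigma> (rev [\<beta> + i + 1..<n + \<beta> + i + 1]))"

definition \<theta> :: "nat \<Rightarrow> nat \<Rightarrow> braid"
  where "\<theta> n \<beta> = list_prod (map (\<tau> \<beta> n) [0..<n])"

definition theta_coset :: "nat \<Rightarrow> nat \<Rightarrow> nat \<Rightarrow> braid \<Rightarrow> braid \<Rightarrow> nat \<Rightarrow> braid set"
  where "theta_coset \<alpha> \<beta> \<gamma> p q n = double_coset \<alpha> (p \<otimes>\<^bsub>B\<^sub>\<infinity>\<^esub> \<theta> n \<beta> \<otimes>\<^bsub>B\<^sub>\<infinity>\<^esub> q) \<gamma>"

text \<open>
  The eventual value of theta_coset over some choice of representatives. The description is
  meaningful only once the eventual value is known to exist and to be independent of that choice.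
  The middle index enters through the element \<theta>, so all three indices are explicit.
\<close>

definition dcoset_comp :: "nat \<Rightarrow> nat \<Rightarrow> nat \<Rightarrow> braid set \<Rightarrow> braid set \<Rightarrow> braid set"
  where "dcoset_comp \<alpha> \<beta> \<gamma> P Q =
    (THE R. \<exists>p\<in>P. \<exists>q\<in>Q. \<forall>\<^sub>F n in sequentially. theta_coset \<alpha> \<beta> \<gamma> p q n = R)"

end

(*
  The element \<theta> n \<beta> interchanges two adjacent blocks of n strands behind the first \<beta> strands.
  We allow blocks of different sizes: swap s k l moves a block of k strands across a block of l
  strands.  Enlarging l multiplies swap s k l on the left, and enlarging k on the right, by an
  element of a deep tail, which commutes with any given braid and is absorbed by the double coset;
  hence the double coset of p (swap \<beta> k l) q does not depend on k and l once they are large.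
  A generator from one block turns into the shifted generator from the other block when it
  passes through swap, and is then absorbed as well; hence the choice of p and q does not matter.
  Associativity then becomes an exact identity,
    swap \<beta> n n b swap \<gamma> m (m + n) = swap \<beta> (n + m) n b swap \<gamma> m m    (\<beta> + n = \<gamma> + m),
  in which both sides split off the same factor swap (\<beta> + n) m n, and this factor commutes with b.
*)

theory Submission
  imports Defs
begin

interpretation BG: group "B\<^sub>\<infinity>"
  by (rule group_braid_group)

abbreviation braid_times :: "braid \<Rightarrow> braid \<Rightarrow> braid"  (infixl \<open>\<cdot>\<close> 70)
  where "x \<cdot> y \<equiv> x \<otimes>\<^bsub>B\<^sub>\<infinity>\<^esub> y"

subsection \<open>Generators, tails and their centralizers\<close>

lemma sigma_closed [simp]: "i \<ge> 1 \<Longrightarrow> \<sigma> i \<in> carrier B\<^sub>\<infinity>"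
  by (auto simp: \<sigma>_def carrier_braid_group braid_words_def intro!: quotientI)

lemma sigma_far:
  assumes "i \<ge> 1" "i + 2 \<le> j"
  shows "\<sigma> i \<cdot> \<sigma> j = \<sigma> j \<cdot> \<sigma> i"
proof -
  have "[(True, i)] \<in> braid_words" "[(True, j)] \<in> braid_words"
    using assms by (auto simp: braid_words_def)
  then show ?thesis
    using equiv_class_eq[OF equiv_braid_rel braid_rel.far[OF assms]]
    by (simp add: \<sigma>_def braid_mult_class)
qed

lemma sigma_braid:
  assumes "i \<ge> 1"
  shows "\<sigma> i \<cdot> \<sigma> (Suc i) \<cdot> \<sigma> i = \<sigma> (Suc i) \<cdot> \<sigma> i \<cdot> \<sigma> (Suc i)"
proof -
  have "[(True, i)] \<in> braid_words" "[(True, Suc i)] \<in> braid_words"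
    "[(True, i), (True, Suc i)] \<in> braid_words" "[(True, Suc i), (True, i)] \<in> braid_words"
    using assms by (auto simp: braid_words_def)
  then show ?thesis
    using equiv_class_eq[OF equiv_braid_rel braid_rel.braid[OF assms]]
    by (simp add: \<sigma>_def braid_mult_class)
qed

lemma sigma_braid_left:
  assumes "i \<ge> 1" "x \<in> carrier B\<^sub>\<infinity>"
  shows "\<sigma> i \<cdot> (\<sigma> (Suc i) \<cdot> (\<sigma> i \<cdot> x)) = \<sigma> (Suc i) \<cdot> (\<sigma> i \<cdot> (\<sigma> (Suc i) \<cdot> x))"
  using arg_cong[OF sigma_braid[OF assms(1)], of "\<lambda>y. y \<cdot> x"] assms by (simp add: BG.m_assoc)

lemma subgroup_braid_tail: "subgroup B\<^sub>\<infinity>[N] B\<^sub>\<infinity>"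
  unfolding braid_tail_def by (rule BG.generate_is_subgroup) auto

lemmas braid_tail_closed = subgroup.m_closed[OF subgroup_braid_tail]
lemmas braid_tail_one = subgroup.one_closed[OF subgroup_braid_tail]
lemmas braid_tail_inv = subgroup.m_inv_closed[OF subgroup_braid_tail]
lemmas braid_tail_carrier = subgroup.mem_carrier[OF subgroup_braid_tail]

lemma sigma_in_tail: "j > N \<Longrightarrow> \<sigma> j \<in> B\<^sub>\<infinity>[N]"
  unfolding braid_tail_def by (rule generate.incl) auto

lemma braid_tail_antimono:
  assumes "x \<in> B\<^sub>\<infinity>[N]" "M \<le> N"
  shows "x \<in> B\<^sub>\<infinity>[M]"
proof -
  have "{\<sigma> j |j. j > N} \<subseteq> {\<sigma> j |j. j > M}"
    using assms(2) by (auto intro: le_less_trans)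
  then show ?thesis
    using assms(1) BG.mono_generate unfolding braid_tail_def by blast
qed

text \<open>Commutation is demanded of generators only, which is easy to verify for products;
  \<open>tail_commute\<close> extends it to the whole tail.\<close>

definition tail_centralizer :: "nat \<Rightarrow> braid set"
  where "tail_centralizer N = {g \<in> carrier B\<^sub>\<infinity>. \<forall>j>N. g \<cdot> \<sigma> j = \<sigma> j \<cdot> g}"

lemma tail_centralizer_carrier: "g \<in> tail_centralizer N \<Longrightarrow> g \<in> carrier B\<^sub>\<infinity>"
  by (simp add: tail_centralizer_def)

lemma tail_centralizer_mono: "g \<in> tail_centralizer M \<Longrightarrow> M \<le> N \<Longrightarrow> g \<in> tail_centralizer N"
  by (auto simp: tail_centralizer_def)

lemma tail_centralizer_one: "\<one>\<^bsub>B\<^sub>\<infinity>\<^esub> \<in> tail_centralizer N"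
  by (simp add: tail_centralizer_def)

lemma tail_centralizer_mult:
  assumes "g \<in> tail_centralizer N" "h \<in> tail_centralizer N"
  shows "g \<cdot> h \<in> tail_centralizer N"
proof -
  have c: "g \<in> carrier B\<^sub>\<infinity>" "h \<in> carrier B\<^sub>\<infinity>"
    using assms by (auto simp: tail_centralizer_def)
  have "g \<cdot> h \<cdot> \<sigma> j = \<sigma> j \<cdot> (g \<cdot> h)" if j: "j > N" for j
  proof -
    have "g \<cdot> h \<cdot> \<sigma> j = g \<cdot> (\<sigma> j \<cdot> h)"
      using j c assms(2) by (simp add: BG.m_assoc tail_centralizer_def)
    also have "\<dots> = \<sigma> j \<cdot> g \<cdot> h"
      using j c assms(1) by (simp add: BG.m_assoc[symmetric] tail_centralizer_def)
    finally show ?thesis using j c by (simp add: BG.m_assoc)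
  qed
  with c show ?thesis by (simp add: tail_centralizer_def)
qed

lemma inv_commute:
  assumes "x \<in> carrier B\<^sub>\<infinity>" "y \<in> carrier B\<^sub>\<infinity>" "x \<cdot> y = y \<cdot> x"
  shows "inv\<^bsub>B\<^sub>\<infinity>\<^esub> x \<cdot> y = y \<cdot> inv\<^bsub>B\<^sub>\<infinity>\<^esub> x"
  using assms by (metis BG.inv_closed BG.inv_solve_left BG.inv_solve_right BG.m_assoc BG.m_closed)

lemma tail_centralizer_inv: "g \<in> tail_centralizer N \<Longrightarrow> inv\<^bsub>B\<^sub>\<infinity>\<^esub> g \<in> tail_centralizer N"
  by (simp add: tail_centralizer_def inv_commute)

text \<open>The strict bound matters: for \<open>j > N > i\<close> the indices differ by at least 2,
  so the far relation applies, while \<sigma> N and \<sigma> (N + 1) are adjacent.\<close>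

lemma sigma_in_tail_centralizer: "i \<ge> 1 \<Longrightarrow> i < N \<Longrightarrow> \<sigma> i \<in> tail_centralizer N"
  by (auto simp: tail_centralizer_def intro!: sigma_far)

lemma tail_commute:
  assumes "g \<in> tail_centralizer N" "x \<in> B\<^sub>\<infinity>[N]"
  shows "g \<cdot> x = x \<cdot> g"
  using assms(2) unfolding braid_tail_def
proof (induction rule: generate.induct)
  case one
  then show ?case using tail_centralizer_carrier[OF assms(1)] by simp
next
  case (incl h)
  then show ?case using assms(1) by (auto simp: tail_centralizer_def)
next
  case (inv h)
  then show ?case
    using assms(1) by (auto simp: tail_centralizer_def inv_commute)
next
  case (eng h1 h2)
  have c: "h1 \<in> carrier B\<^sub>\<infinity>" "h2 \<in> carrier B\<^sub>\<infinity>" "g \<in> carrier B\<^sub>\<infinity>"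
    using eng.hyps braid_tail_carrier[of _ N] tail_centralizer_carrier[OF assms(1)]
    by (auto simp: braid_tail_def)
  have "g \<cdot> (h1 \<cdot> h2) = h1 \<cdot> g \<cdot> h2"
    using c eng.IH by (simp add: BG.m_assoc[symmetric])
  also have "\<dots> = h1 \<cdot> (h2 \<cdot> g)"
    using c eng.IH by (simp add: BG.m_assoc)
  finally show ?case using c by (simp add: BG.m_assoc)
qed

text \<open>A word involves finitely many generators, so it commutes with every generator of
  sufficiently large index.\<close>

lemma braid_word_class_centralizes:
  "w \<in> braid_words \<Longrightarrow> \<exists>N. braid_rel `` {w} \<in> tail_centralizer N"
proof (induction w)
  case Nil
  show ?case using tail_centralizer_one by (auto simp: one_braid_group)
next
  case (Cons x w)
  obtain e i where x: "x = (e, i)" by (cases x)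
  have i: "i \<ge> 1" and w: "w \<in> braid_words" and xw: "[(e, i)] \<in> braid_words" for e
    using Cons.prems x by (auto simp: braid_words_def)
  obtain N where N: "braid_rel `` {w} \<in> tail_centralizer N"
    using Cons.IH w by blast
  have s: "\<sigma> i \<in> tail_centralizer (max N (Suc i))"
    using i by (intro sigma_in_tail_centralizer) auto
  \<comment> \<open>The class of a formal inverse letter is the group inverse of the generator, so
    closure under inverses covers negative letters.\<close>
  have "braid_rel `` {[(False, i)]} \<cdot> \<sigma> i = \<one>\<^bsub>B\<^sub>\<infinity>\<^esub>"
    using xw equiv_class_eq[OF equiv_braid_rel braid_rel.cancel[OF i, of False]]
    by (simp add: \<sigma>_def braid_mult_class one_braid_group)
  moreover have "braid_rel `` {[(False, i)]} \<in> carrier B\<^sub>\<infinity>"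
    using xw by (auto simp: carrier_braid_group intro: quotientI)
  ultimately have "braid_rel `` {[(False, i)]} = inv\<^bsub>B\<^sub>\<infinity>\<^esub> (\<sigma> i)"
    using i by (metis BG.inv_equality sigma_closed)
  then have "braid_rel `` {[x]} \<in> tail_centralizer (max N (Suc i))"
    using s tail_centralizer_inv[OF s] x by (cases e) (auto simp: \<sigma>_def)
  moreover have "braid_rel `` {w} \<in> tail_centralizer (max N (Suc i))"
    using N by (rule tail_centralizer_mono) simp
  ultimately have "braid_rel `` {[x]} \<cdot> braid_rel `` {w} \<in> tail_centralizer (max N (Suc i))"
    by (rule tail_centralizer_mult)
  then show ?case using xw w x by (auto simp: braid_mult_class)
qed

lemma eventually_tail_centralizer:
  assumes "g \<in> carrier B\<^sub>\<infinity>"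
  shows "\<forall>\<^sub>F N in sequentially. g \<in> tail_centralizer (c + N)"
proof -
  obtain M where "g \<in> tail_centralizer M"
    using assms braid_word_class_centralizes
    by (auto simp: carrier_braid_group elim!: quotientE)
  then show ?thesis
    unfolding eventually_sequentially by (intro exI[of _ M]) (auto intro: tail_centralizer_mono)
qed

subsection \<open>Interchanging two blocks of strands\<close>

text \<open>The word \<sigma> (s + l) ... \<sigma> (s + 1), which carries one strand across l
  others; it is \<tau> with the starting index as a single parameter.\<close>

primrec descent :: "nat \<Rightarrow> nat \<Rightarrow> braid"
  where
    "descent s 0 = \<one>\<^bsub>B\<^sub>\<infinity>\<^esub>"
  | "descent s (Suc l) = \<sigma> (Suc (s + l)) \<cdot> descent s l"

primrec swap :: "nat \<Rightarrow> nat \<Rightarrow> nat \<Rightarrow> braid"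
  where
    "swap s 0 l = \<one>\<^bsub>B\<^sub>\<infinity>\<^esub>"
  | "swap s (Suc k) l = swap s k l \<cdot> descent (s + k) l"

lemma descent_in_tail: "descent s l \<in> B\<^sub>\<infinity>[s]"
  by (induction l) (simp_all add: braid_tail_one braid_tail_closed sigma_in_tail)

lemma swap_in_tail: "swap s k l \<in> B\<^sub>\<infinity>[s]"
  by (induction k)
    (simp_all add: braid_tail_one braid_tail_closed braid_tail_antimono[OF descent_in_tail])

lemma descent_closed [simp]: "descent s l \<in> carrier B\<^sub>\<infinity>"
  using braid_tail_carrier[OF descent_in_tail] .

lemma swap_closed [simp]: "swap s k l \<in> carrier B\<^sub>\<infinity>"
  using braid_tail_carrier[OF swap_in_tail] .

lemma descent_centralizes: "s + l < N \<Longrightarrow> descent s l \<in> tail_centralizer N"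
  by (induction l)
    (simp_all add: tail_centralizer_one tail_centralizer_mult sigma_in_tail_centralizer)

text \<open>For positive k and l the highest generator is \<sigma> (s + k + l - 1), from the last
  factor; hence the bound is nonstrict here but strict in
  \<open>descent_centralizes\<close>.\<close>

lemma swap_centralizes: "s + k + l \<le> N \<Longrightarrow> swap s k l \<in> tail_centralizer N"
  by (induction k)
    (simp_all add: tail_centralizer_one tail_centralizer_mult descent_centralizes)

lemma descent_add: "descent s (l + l') = descent (s + l) l' \<cdot> descent s l"
  by (induction l') (simp_all add: BG.m_assoc add.assoc)

lemma swap_add_left: "swap s (k + k') l = swap s k l \<cdot> swap (s + k) k' l"
  by (induction k') (simp_all add: BG.m_assoc add.assoc)

text \<open>Each descent splits into an upper and a lower part; every upper part moves left past the
  lower parts of the earlier factors, which commute with it.\<close>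

lemma swap_add_right: "swap s k (l + l') = swap (s + l) k l' \<cdot> swap s k l"
proof (induction k)
  case (Suc k)
  have comm: "swap s k l \<cdot> descent (s + k + l) l' = descent (s + k + l) l' \<cdot> swap s k l"
    by (rule tail_commute[OF swap_centralizes descent_in_tail]) simp
  have "swap s (Suc k) (l + l')
      = swap (s + l) k l' \<cdot> (swap s k l \<cdot> descent (s + k + l) l') \<cdot> descent (s + k) l"
    by (simp add: Suc descent_add BG.m_assoc)
  also have "\<dots> = swap (s + l) (Suc k) l' \<cdot> swap s (Suc k) l"
    unfolding comm by (simp add: BG.m_assoc add_ac)
  finally show ?case .
qed simp

text \<open>\<sigma> j commutes with the factors of index at least j + 2, is converted by the braid
  relation at \<sigma> (j + 1) \<sigma> j, and emerges as \<sigma> (j + 1), which commutes with the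
  remaining lower factors.\<close>

lemma sigma_descent:
  assumes "s < j" "j < s + l"
  shows "\<sigma> j \<cdot> descent s l = descent s l \<cdot> \<sigma> (Suc j)"
  using assms
proof (induction l)
  case (Suc l)
  show ?case
  proof (cases "j < s + l")
    case True
    have "\<sigma> j \<cdot> descent s (Suc l) = \<sigma> j \<cdot> \<sigma> (Suc (s + l)) \<cdot> descent s l"
      using Suc.prems by (simp add: BG.m_assoc)
    also have "\<sigma> j \<cdot> \<sigma> (Suc (s + l)) = \<sigma> (Suc (s + l)) \<cdot> \<sigma> j"
      using Suc.prems True by (intro sigma_far) auto
    also have "\<dots> \<cdot> descent s l = \<sigma> (Suc (s + l)) \<cdot> (descent s l \<cdot> \<sigma> (Suc j))"
      using Suc.IH Suc.prems True by (simp add: BG.m_assoc)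
    finally show ?thesis using Suc.prems by (simp add: BG.m_assoc)
  next
    case False
    \<comment> \<open>Here j = s + l, and \<open>s < j\<close> forces l > 0; the two leading factors
      are therefore \<sigma> (j + 1) and \<sigma> j.\<close>
    with Suc.prems obtain l0 where l: "l = Suc l0"
      by (cases l) auto
    have j: "j = Suc (s + l0)"
      using False Suc.prems l by simp
    have "\<sigma> j \<cdot> descent s (Suc l) = \<sigma> j \<cdot> \<sigma> (Suc j) \<cdot> \<sigma> j \<cdot> descent s l0"
      by (simp add: l j BG.m_assoc)
    also have "\<dots> = \<sigma> (Suc j) \<cdot> \<sigma> j \<cdot> (\<sigma> (Suc j) \<cdot> descent s l0)"
      by (simp add: sigma_braid_left j BG.m_assoc)
    also have "\<sigma> (Suc j) \<cdot> descent s l0 = descent s l0 \<cdot> \<sigma> (Suc j)"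
      by (rule tail_commute[OF descent_centralizes sigma_in_tail, symmetric, of _ _ j])
        (simp_all add: j)
    finally show ?thesis by (simp add: l j BG.m_assoc)
  qed
qed simp

text \<open>Each of the k descents raises the index by one. After k of them it is j + k, strictly
  between s + k and s + k + l, so the next descent acts in the same way.\<close>

lemma sigma_swap:
  assumes "s < j" "j < s + l"
  shows "\<sigma> j \<cdot> swap s k l = swap s k l \<cdot> \<sigma> (j + k)"
proof (induction k)
  case 0
  then show ?case using assms by simp
next
  case (Suc k)
  have "\<sigma> j \<cdot> swap s (Suc k) l = swap s k l \<cdot> (\<sigma> (j + k) \<cdot> descent (s + k) l)"
    using Suc assms by (simp add: BG.m_assoc[symmetric])
  also have "\<dots> = swap s (Suc k) l \<cdot> \<sigma> (j + Suc k)"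
    using assms by (simp add: sigma_descent BG.m_assoc)
  finally show ?case .
qed

text \<open>Mirror image of \<open>sigma_descent\<close>: with l = 1 the swap is the ascending word
  \<sigma> (s + 1) ... \<sigma> (s + k), and the generator enters from the right.\<close>

lemma swap_one_sigma:
  assumes "s < j" "j < s + k"
  shows "swap s k 1 \<cdot> \<sigma> j = \<sigma> (Suc j) \<cdot> swap s k 1"
  using assms
proof (induction k)
  case (Suc k)
  have step: "swap s (Suc i) 1 = swap s i 1 \<cdot> \<sigma> (Suc (s + i))" for i
    by simp
  show ?case
  proof (cases "j < s + k")
    case True
    have "swap s (Suc k) 1 \<cdot> \<sigma> j = swap s k 1 \<cdot> (\<sigma> (Suc (s + k)) \<cdot> \<sigma> j)"
      using Suc.prems unfolding step by (simp add: BG.m_assoc)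
    also have "\<sigma> (Suc (s + k)) \<cdot> \<sigma> j = \<sigma> j \<cdot> \<sigma> (Suc (s + k))"
      using Suc.prems True by (intro sigma_far[symmetric]) auto
    also have "swap s k 1 \<cdot> \<dots> = swap s k 1 \<cdot> \<sigma> j \<cdot> \<sigma> (Suc (s + k))"
      using Suc.prems by (simp add: BG.m_assoc)
    also have "swap s k 1 \<cdot> \<sigma> j = \<sigma> (Suc j) \<cdot> swap s k 1"
      using Suc.IH Suc.prems True by simp
    finally show ?thesis
      using Suc.prems unfolding step by (simp add: BG.m_assoc)
  next
    case False
    with Suc.prems obtain k0 where k: "k = Suc k0"
      by (cases k) auto
    have j: "j = Suc (s + k0)"
      using False Suc.prems k by simp
    have j1: "j \<ge> 1" by (simp add: j)
    have "swap s (Suc k) 1 \<cdot> \<sigma> j = swap s k0 1 \<cdot> (\<sigma> j \<cdot> \<sigma> (Suc j) \<cdot> \<sigma> j)"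
      unfolding k step by (simp add: j BG.m_assoc)
    also have "\<dots> = swap s k0 1 \<cdot> \<sigma> (Suc j) \<cdot> (\<sigma> j \<cdot> \<sigma> (Suc j))"
      unfolding sigma_braid[OF j1] using j by (simp add: BG.m_assoc)
    also have "swap s k0 1 \<cdot> \<sigma> (Suc j) = \<sigma> (Suc j) \<cdot> swap s k0 1"
      by (rule tail_commute[OF swap_centralizes sigma_in_tail, of _ _ _ j]) (simp_all add: j)
    finally show ?thesis unfolding k step by (simp add: j BG.m_assoc)
  qed
qed simp

text \<open>Induction on l rather than on the recursion argument k: \<open>swap_add_right\<close>
  peels off one crossed strand at a time, and each raises the index by one.\<close>

lemma swap_sigma:
  assumes "s < j" "j < s + k"
  shows "swap s k l \<cdot> \<sigma> j = \<sigma> (j + l) \<cdot> swap s k l"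
proof (induction l)
  case 0
  have "swap s k 0 = \<one>\<^bsub>B\<^sub>\<infinity>\<^esub>" for k by (induction k) auto
  then show ?case using assms by simp
next
  case (Suc l)
  have step: "swap s k (Suc l) = swap (s + l) k 1 \<cdot> swap s k l"
    using swap_add_right[of s k l 1] by simp
  have "swap s k (Suc l) \<cdot> \<sigma> j = swap (s + l) k 1 \<cdot> \<sigma> (j + l) \<cdot> swap s k l"
    using Suc assms unfolding step by (simp add: BG.m_assoc)
  also have "swap (s + l) k 1 \<cdot> \<sigma> (j + l) = \<sigma> (Suc (j + l)) \<cdot> swap (s + l) k 1"
    using assms by (intro swap_one_sigma) auto
  finally show ?case
    using assms unfolding step by (simp add: BG.m_assoc)
qed

section \<open>The elements \<theta> as swaps of equal blocks\<close>

lemma list_prod_Nil [simp]: "list_prod [] = \<one>\<^bsub>B\<^sub>\<infinity>\<^esub>"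
  by (simp add: list_prod_def)

lemma list_prod_Cons [simp]: "list_prod (x # xs) = x \<cdot> list_prod xs"
  by (simp add: list_prod_def)

lemma list_prod_closed: "set xs \<subseteq> carrier B\<^sub>\<infinity> \<Longrightarrow> list_prod xs \<in> carrier B\<^sub>\<infinity>"
  by (induction xs) auto

lemma list_prod_snoc:
  assumes "set xs \<subseteq> carrier B\<^sub>\<infinity>" "x \<in> carrier B\<^sub>\<infinity>"
  shows "list_prod (xs @ [x]) = list_prod xs \<cdot> x"
  using assms by (induction xs) (auto simp: BG.m_assoc list_prod_closed)

lemma tau_eq_descent: "\<tau> \<beta> n i = descent (\<beta> + i) n"
proof -
  have "list_prod (map \<sigma> (rev [Suc s..<Suc (n + s)])) = descent s n" for s
    by (induction n) (simp_all add: add.commute)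
  from this[of "\<beta> + i"] show ?thesis by (simp add: \<tau>_def add_ac)
qed

lemma theta_eq_swap: "\<theta> n \<beta> = swap \<beta> n n"
proof -
  \<comment> \<open>The number k of factors is separated from their length n, so that the induction
    can run on k alone.\<close>
  have "list_prod (map (\<tau> \<beta> n) [0..<k]) = swap \<beta> k n" for k
    by (induction k) (simp_all add: list_prod_snoc tau_eq_descent image_subset_iff)
  then show ?thesis by (simp add: \<theta>_def)
qed

subsection \<open>Double cosets\<close>

lemma double_coset_iff:
  "x \<in> double_coset \<alpha> g \<beta> \<longleftrightarrow> (\<exists>a\<in>B\<^sub>\<infinity>[\<alpha>]. \<exists>b\<in>B\<^sub>\<infinity>[\<beta>]. x = a \<cdot> g \<cdot> b)"
  by (auto simp: double_coset_def r_coset_def set_mult_def)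

lemma double_coset_self: "g \<in> carrier B\<^sub>\<infinity> \<Longrightarrow> g \<in> double_coset \<alpha> g \<beta>"
  unfolding double_coset_iff
  by (intro bexI[of _ "\<one>\<^bsub>B\<^sub>\<infinity>\<^esub>"]) (simp_all add: braid_tail_one)

lemma double_coset_absorb:
  assumes "a \<in> B\<^sub>\<infinity>[\<alpha>]" "g \<in> carrier B\<^sub>\<infinity>" "b \<in> B\<^sub>\<infinity>[\<beta>]"
  shows "double_coset \<alpha> (a \<cdot> g \<cdot> b) \<beta> = double_coset \<alpha> g \<beta>"
proof -
  \<comment> \<open>Proved for arbitrary elements because the reverse inclusion is the same claim
    applied to the inverses of a and b.\<close>
  have sub: "double_coset \<alpha> (a \<cdot> g \<cdot> b) \<beta> \<subseteq> double_coset \<alpha> g \<beta>"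
    if "a \<in> B\<^sub>\<infinity>[\<alpha>]" "g \<in> carrier B\<^sub>\<infinity>" "b \<in> B\<^sub>\<infinity>[\<beta>]" for a g b
  proof
    fix x assume "x \<in> double_coset \<alpha> (a \<cdot> g \<cdot> b) \<beta>"
    then obtain a' b' where x: "a' \<in> B\<^sub>\<infinity>[\<alpha>]" "b' \<in> B\<^sub>\<infinity>[\<beta>]" "x = a' \<cdot> (a \<cdot> g \<cdot> b) \<cdot> b'"
      by (auto simp: double_coset_iff)
    then have "x = (a' \<cdot> a) \<cdot> g \<cdot> (b \<cdot> b')"
      using that by (simp add: BG.m_assoc braid_tail_carrier)
    then show "x \<in> double_coset \<alpha> g \<beta>"
      unfolding double_coset_iff using x that by (blast intro: braid_tail_closed)
  qed
  have "inv\<^bsub>B\<^sub>\<infinity>\<^esub> a \<cdot> (a \<cdot> g) = g"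
    using assms braid_tail_carrier[OF assms(1)] by (simp add: BG.m_assoc[symmetric])
  then have "g = inv\<^bsub>B\<^sub>\<infinity>\<^esub> a \<cdot> (a \<cdot> g \<cdot> b) \<cdot> inv\<^bsub>B\<^sub>\<infinity>\<^esub> b"
    using assms braid_tail_carrier[OF assms(1)] braid_tail_carrier[OF assms(3)]
    by (simp add: BG.m_assoc)
  then have "double_coset \<alpha> g \<beta> \<subseteq> double_coset \<alpha> (a \<cdot> g \<cdot> b) \<beta>"
    using assms sub[of "inv\<^bsub>B\<^sub>\<infinity>\<^esub> a" "a \<cdot> g \<cdot> b" "inv\<^bsub>B\<^sub>\<infinity>\<^esub> b"]
    by (auto simp: braid_tail_inv braid_tail_carrier)
  with sub[OF assms] show ?thesis by blast
qed

lemma double_coset_absorb_left: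
  assumes "a \<in> B\<^sub>\<infinity>[\<alpha>]" "g \<in> carrier B\<^sub>\<infinity>"
  shows "double_coset \<alpha> (a \<cdot> g) \<beta> = double_coset \<alpha> g \<beta>"
  using double_coset_absorb[OF assms braid_tail_one] assms by (simp add: braid_tail_carrier)

lemma double_coset_absorb_right:
  assumes "g \<in> carrier B\<^sub>\<infinity>" "b \<in> B\<^sub>\<infinity>[\<beta>]"
  shows "double_coset \<alpha> (g \<cdot> b) \<beta> = double_coset \<alpha> g \<beta>"
  using double_coset_absorb[OF braid_tail_one assms] assms by simp

section \<open>Independence of the block sizes\<close>

text \<open>The additional crossed strands contribute a left factor from
  \<open>B\<^sub>\<infinity>[\<beta> + l]\<close>, which passes p and is absorbed by the tail of
  index \<alpha>.\<close>

lemma swap_coset_stable_right: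
  assumes "p \<in> tail_centralizer (\<beta> + l)" "q \<in> carrier B\<^sub>\<infinity>" "\<alpha> \<le> \<beta> + l" "l \<le> l'"
  shows "double_coset \<alpha> (p \<cdot> swap \<beta> k l' \<cdot> q) \<gamma> = double_coset \<alpha> (p \<cdot> swap \<beta> k l \<cdot> q) \<gamma>"
proof -
  obtain d where d: "l' = l + d" using assms(4) le_Suc_ex by blast
  let ?u = "swap (\<beta> + l) k d"
  have p: "p \<in> carrier B\<^sub>\<infinity>" using assms(1) by (rule tail_centralizer_carrier)
  have "p \<cdot> ?u = ?u \<cdot> p"
    using assms(1) swap_in_tail by (rule tail_commute)
  then have "p \<cdot> swap \<beta> k l' \<cdot> q = ?u \<cdot> (p \<cdot> swap \<beta> k l \<cdot> q)"
    unfolding d swap_add_right using p assms(2) by (simp add: BG.m_assoc[symmetric])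
  then show ?thesis
    using p assms braid_tail_antimono[OF swap_in_tail assms(3)]
    by (simp add: double_coset_absorb_left)
qed

text \<open>Dually, additional strands in the moving block contribute a right factor, which passes q
  and is absorbed by the tail of index \<gamma>.\<close>

lemma swap_coset_stable_left:
  assumes "p \<in> carrier B\<^sub>\<infinity>" "q \<in> tail_centralizer (\<beta> + k)" "\<gamma> \<le> \<beta> + k" "k \<le> k'"
  shows "double_coset \<alpha> (p \<cdot> swap \<beta> k' l \<cdot> q) \<gamma> = double_coset \<alpha> (p \<cdot> swap \<beta> k l \<cdot> q) \<gamma>"
proof -
  obtain d where d: "k' = k + d" using assms(4) le_Suc_ex by blast
  let ?u = "swap (\<beta> + k) d l"
  have q: "q \<in> carrier B\<^sub>\<infinity>" using assms(2) by (rule tail_centralizer_carrier)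
  have "q \<cdot> ?u = ?u \<cdot> q"
    using assms(2) swap_in_tail by (rule tail_commute)
  then have "p \<cdot> swap \<beta> k' l \<cdot> q = p \<cdot> swap \<beta> k l \<cdot> q \<cdot> ?u"
    unfolding d swap_add_left using q assms(1) by (simp add: BG.m_assoc)
  then show ?thesis
    using q assms braid_tail_antimono[OF swap_in_tail assms(3)]
    by (simp add: double_coset_absorb_right)
qed

text \<open>The sizes shrink one at a time, from (n', n') through (n, n') to (n, n).\<close>

lemma theta_coset_stable:
  assumes "p \<in> tail_centralizer (\<beta> + n)" "q \<in> tail_centralizer (\<beta> + n)"
    "\<alpha> \<le> \<beta> + n" "\<gamma> \<le> \<beta> + n" "n \<le> n'"
  shows "theta_coset \<alpha> \<beta> \<gamma> p q n' = theta_coset \<alpha> \<beta> \<gamma> p q n"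
  using assms swap_coset_stable_left[of p q \<beta> n \<gamma> n' \<alpha> n']
    swap_coset_stable_right[of p \<beta> n q \<alpha> n' n \<gamma>]
  by (simp add: theta_coset_def theta_eq_swap tail_centralizer_carrier)

section \<open>Independence of the representatives\<close>

lemma eventually_ge_add: "\<forall>\<^sub>F n in sequentially. c \<le> b + (n :: nat)"
  unfolding eventually_sequentially by (intro exI[of _ c]) auto

lemma eventually_less_add: "\<forall>\<^sub>F n in sequentially. c < b + (n :: nat)"
  unfolding eventually_sequentially by (intro exI[of _ "Suc c"]) auto

text \<open>A generator \<sigma> j to the right of p crosses the swap as \<sigma> (j + n); for large
  n this commutes with q and lies in the tail of index \<gamma>.\<close>

lemma theta_coset_tail_left:
  assumes "b \<in> B\<^sub>\<infinity>[\<beta>]" "p \<in> carrier B\<^sub>\<infinity>" "q \<in> carrier B\<^sub>\<infinity>"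
  shows "\<forall>\<^sub>F n in sequentially. theta_coset \<alpha> \<beta> \<gamma> (p \<cdot> b) q n = theta_coset \<alpha> \<beta> \<gamma> p q n"
proof -
  have gen: "\<forall>\<^sub>F n in sequentially. theta_coset \<alpha> \<beta> \<gamma> (p \<cdot> \<sigma> j) q n = theta_coset \<alpha> \<beta> \<gamma> p q n"
    if j: "j > \<beta>" and p: "p \<in> carrier B\<^sub>\<infinity>" for j p
    using eventually_less_add[of j \<beta>] eventually_ge_add[of \<gamma> \<beta>]
      eventually_tail_centralizer[OF assms(3), of \<beta>]
  proof eventually_elim
    case (elim n)
    have "p \<cdot> \<sigma> j \<cdot> swap \<beta> n n \<cdot> q = p \<cdot> swap \<beta> n n \<cdot> (\<sigma> (j + n) \<cdot> q)"
      using j p elim assms(3) sigma_swap[of \<beta> j n n] by (simp add: BG.m_assoc)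
    also have "\<sigma> (j + n) \<cdot> q = q \<cdot> \<sigma> (j + n)"
      using elim j by (simp add: tail_centralizer_def)
    also have "p \<cdot> swap \<beta> n n \<cdot> \<dots> = p \<cdot> swap \<beta> n n \<cdot> q \<cdot> \<sigma> (j + n)"
      using j p assms(3) by (simp add: BG.m_assoc)
    finally show ?case
      using j p elim assms(3)
      by (simp add: theta_coset_def theta_eq_swap double_coset_absorb_right sigma_in_tail)
  qed
  show ?thesis
    using assms(1,2) unfolding braid_tail_def
  \<comment> \<open>p must vary: in a product h1 h2 the factor h2 is removed with p h1 in place of
    p.\<close>
  proof (induction arbitrary: p rule: generate.induct)
    case one
    then show ?case by simp
  next
    case (incl h)
    then show ?case using gen by auto
  next
    case (inv h)
    then obtain j where h: "h = \<sigma> j" "j > \<beta>" by auto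
    \<comment> \<open>For an inverse generator, the positive case is applied to
      \<open>p \<cdot> inv h\<close>: the generator cancels and the equality is read
      backwards.\<close>
    have "\<forall>\<^sub>F n in sequentially. theta_coset \<alpha> \<beta> \<gamma> (p \<cdot> inv\<^bsub>B\<^sub>\<infinity>\<^esub> h \<cdot> \<sigma> j) q n
        = theta_coset \<alpha> \<beta> \<gamma> (p \<cdot> inv\<^bsub>B\<^sub>\<infinity>\<^esub> h) q n"
      using h inv.prems by (intro gen) auto
    then show ?case using h inv.prems by (simp add: BG.m_assoc eq_commute[of _ "theta_coset \<alpha> \<beta> \<gamma> p q _"])
  next
    case (eng h1 h2)
    have c: "h1 \<in> carrier B\<^sub>\<infinity>" "h2 \<in> carrier B\<^sub>\<infinity>"
      using eng.hyps braid_tail_carrier[of _ \<beta>] by (auto simp: braid_tail_def)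
    from eng.IH(1)[OF eng.prems] eng.IH(2)[of "p \<cdot> h1"] show ?case
      using c eng.prems by (auto simp: BG.m_assoc elim: eventually_elim2)
  qed
qed

text \<open>Here the generator crosses from right to left by \<open>swap_sigma\<close>, commutes
  with p and is absorbed by the tail of index \<alpha>.\<close>

lemma theta_coset_tail_right:
  assumes "b \<in> B\<^sub>\<infinity>[\<beta>]" "p \<in> carrier B\<^sub>\<infinity>" "q \<in> carrier B\<^sub>\<infinity>"
  shows "\<forall>\<^sub>F n in sequentially. theta_coset \<alpha> \<beta> \<gamma> p (b \<cdot> q) n = theta_coset \<alpha> \<beta> \<gamma> p q n"
proof -
  have gen: "\<forall>\<^sub>F n in sequentially. theta_coset \<alpha> \<beta> \<gamma> p (\<sigma> j \<cdot> q) n = theta_coset \<alpha> \<beta> \<gamma> p q n"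
    if j: "j > \<beta>" and q: "q \<in> carrier B\<^sub>\<infinity>" for j q
    using eventually_less_add[of j \<beta>] eventually_ge_add[of \<alpha> \<beta>]
      eventually_tail_centralizer[OF assms(2), of \<beta>]
  proof eventually_elim
    case (elim n)
    have "p \<cdot> swap \<beta> n n \<cdot> (\<sigma> j \<cdot> q) = p \<cdot> (swap \<beta> n n \<cdot> \<sigma> j) \<cdot> q"
      using j q assms(2) by (simp add: BG.m_assoc)
    also have "swap \<beta> n n \<cdot> \<sigma> j = \<sigma> (j + n) \<cdot> swap \<beta> n n"
      using j elim by (intro swap_sigma) auto
    also have "p \<cdot> \<dots> \<cdot> q = p \<cdot> \<sigma> (j + n) \<cdot> (swap \<beta> n n \<cdot> q)"
      using j q assms(2) by (simp add: BG.m_assoc)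
    also have "p \<cdot> \<sigma> (j + n) = \<sigma> (j + n) \<cdot> p"
      using elim j by (simp add: tail_centralizer_def)
    also have "\<dots> \<cdot> (swap \<beta> n n \<cdot> q) = \<sigma> (j + n) \<cdot> (p \<cdot> swap \<beta> n n \<cdot> q)"
      using j q assms(2) by (simp add: BG.m_assoc)
    finally show ?case
      using j q elim assms(2)
      by (simp add: theta_coset_def theta_eq_swap double_coset_absorb_left sigma_in_tail)
  qed
  show ?thesis
    using assms(1,3) unfolding braid_tail_def
  proof (induction arbitrary: q rule: generate.induct)
    case one
    then show ?case by simp
  next
    case (incl h)
    then show ?case using gen by auto
  next
    case (inv h)
    then obtain j where h: "h = \<sigma> j" "j > \<beta>" by auto
    have "\<forall>\<^sub>F n in sequentially. theta_coset \<alpha> \<beta> \<gamma> p (\<sigma> j \<cdot> (inv\<^bsub>B\<^sub>\<infinity>\<^esub> h \<cdot> q)) n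
        = theta_coset \<alpha> \<beta> \<gamma> p (inv\<^bsub>B\<^sub>\<infinity>\<^esub> h \<cdot> q) n"
      using h inv.prems by (intro gen) auto
    then show ?case using h inv.prems by (simp add: BG.m_assoc[symmetric] eq_commute[of _ "theta_coset \<alpha> \<beta> \<gamma> p q _"])
  next
    case (eng h1 h2)
    have c: "h1 \<in> carrier B\<^sub>\<infinity>" "h2 \<in> carrier B\<^sub>\<infinity>"
      using eng.hyps braid_tail_carrier[of _ \<beta>] by (auto simp: braid_tail_def)
    from eng.IH(2)[OF eng.prems] eng.IH(1)[of "h2 \<cdot> q"] show ?case
      using c eng.prems by (auto simp: BG.m_assoc elim: eventually_elim2)
  qed
qed

lemma theta_coset_representatives:
  assumes "g \<in> carrier B\<^sub>\<infinity>" "h \<in> carrier B\<^sub>\<infinity>"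
    and "p \<in> double_coset \<alpha> g \<beta>" "q \<in> double_coset \<beta> h \<gamma>"
  shows "\<forall>\<^sub>F n in sequentially. theta_coset \<alpha> \<beta> \<gamma> p q n = theta_coset \<alpha> \<beta> \<gamma> g h n"
proof -
  obtain a b where p: "a \<in> B\<^sub>\<infinity>[\<alpha>]" "b \<in> B\<^sub>\<infinity>[\<beta>]" "p = a \<cdot> g \<cdot> b"
    using assms(3) by (auto simp: double_coset_iff)
  obtain b' c where q: "b' \<in> B\<^sub>\<infinity>[\<beta>]" "c \<in> B\<^sub>\<infinity>[\<gamma>]" "q = b' \<cdot> h \<cdot> c"
    using assms(4) by (auto simp: double_coset_iff)
  have car: "a \<in> carrier B\<^sub>\<infinity>" "b \<in> carrier B\<^sub>\<infinity>" "b' \<in> carrier B\<^sub>\<infinity>" "c \<in> carrier B\<^sub>\<infinity>"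
    using p q braid_tail_carrier by blast+
  \<comment> \<open>The outer factors a and c are absorbed for every n; the inner factors b and b'
    disappear only for large n.\<close>
  have "theta_coset \<alpha> \<beta> \<gamma> p q n = theta_coset \<alpha> \<beta> \<gamma> (g \<cdot> b) (b' \<cdot> h) n" for n
    using double_coset_absorb[OF p(1) _ q(2), of "g \<cdot> b \<cdot> swap \<beta> n n \<cdot> (b' \<cdot> h)"] car assms(1,2)
    by (simp add: theta_coset_def theta_eq_swap p(3) q(3) BG.m_assoc)
  moreover have "\<forall>\<^sub>F n in sequentially.
      theta_coset \<alpha> \<beta> \<gamma> (g \<cdot> b) (b' \<cdot> h) n = theta_coset \<alpha> \<beta> \<gamma> g (b' \<cdot> h) n"
    using p car assms by (intro theta_coset_tail_left) auto
  moreover have "\<forall>\<^sub>F n in sequentially.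
      theta_coset \<alpha> \<beta> \<gamma> g (b' \<cdot> h) n = theta_coset \<alpha> \<beta> \<gamma> g h n"
    using q assms by (intro theta_coset_tail_right) auto
  ultimately show ?thesis by (auto elim: eventually_elim2)
qed

section \<open>Composition of double cosets and associativity\<close>

lemma theta_coset_eventually:
  assumes "g \<in> tail_centralizer (\<beta> + n)" "h \<in> tail_centralizer (\<beta> + n)"
    "\<alpha> \<le> \<beta> + n" "\<gamma> \<le> \<beta> + n"
    and "p \<in> double_coset \<alpha> g \<beta>" "q \<in> double_coset \<beta> h \<gamma>"
  shows "\<forall>\<^sub>F i in sequentially. theta_coset \<alpha> \<beta> \<gamma> p q i = theta_coset \<alpha> \<beta> \<gamma> g h n"
proof -
  have "\<forall>\<^sub>F i in sequentially. theta_coset \<alpha> \<beta> \<gamma> p q i = theta_coset \<alpha> \<beta> \<gamma> g h i"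
    using assms by (intro theta_coset_representatives) (auto dest: tail_centralizer_carrier)
  then show ?thesis
    using eventually_ge_at_top[of n]
  proof eventually_elim
    case (elim i)
    then show ?case using theta_coset_stable[OF assms(1-4), of i] by simp
  qed
qed

text \<open>This turns the definite description into an explicit double coset at any one
  sufficiently large n, so that compositions can be computed and nested.\<close>

lemma dcoset_comp_eq:
  assumes "g \<in> tail_centralizer (\<beta> + n)" "h \<in> tail_centralizer (\<beta> + n)"
    "\<alpha> \<le> \<beta> + n" "\<gamma> \<le> \<beta> + n"
  shows "dcoset_comp \<alpha> \<beta> \<gamma> (double_coset \<alpha> g \<beta>) (double_coset \<beta> h \<gamma>)
    = double_coset \<alpha> (g \<cdot> swap \<beta> n n \<cdot> h) \<gamma>"
proof -
  have "dcoset_comp \<alpha> \<beta> \<gamma> (double_coset \<alpha> g \<beta>) (double_coset \<beta> h \<gamma>) = theta_coset \<alpha> \<beta> \<gamma> g h n"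
    unfolding dcoset_comp_def
  proof (rule the_equality)
    show "\<exists>p\<in>double_coset \<alpha> g \<beta>. \<exists>q\<in>double_coset \<beta> h \<gamma>.
        \<forall>\<^sub>F i in sequentially. theta_coset \<alpha> \<beta> \<gamma> p q i = theta_coset \<alpha> \<beta> \<gamma> g h n"
      using theta_coset_eventually[OF assms] assms(1,2)
      by (meson double_coset_self tail_centralizer_carrier)
  next
    fix R
    assume "\<exists>p\<in>double_coset \<alpha> g \<beta>. \<exists>q\<in>double_coset \<beta> h \<gamma>.
        \<forall>\<^sub>F i in sequentially. theta_coset \<alpha> \<beta> \<gamma> p q i = R"
    then obtain p q where "p \<in> double_coset \<alpha> g \<beta>" "q \<in> double_coset \<beta> h \<gamma>"
      and R: "\<forall>\<^sub>F i in sequentially. theta_coset \<alpha> \<beta> \<gamma> p q i = R" by blast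
    then have "\<forall>\<^sub>F i in sequentially. theta_coset \<alpha> \<beta> \<gamma> p q i = theta_coset \<alpha> \<beta> \<gamma> g h n"
      using theta_coset_eventually[OF assms] by blast
    \<comment> \<open>Two eventual values of one sequence agree, since \<open>sequentially\<close>
      is a nontrivial filter.\<close>
    with R have "\<forall>\<^sub>F i :: nat in sequentially. R = theta_coset \<alpha> \<beta> \<gamma> g h n"
      by eventually_elim simp
    then show "R = theta_coset \<alpha> \<beta> \<gamma> g h n" by simp
  qed
  then show ?thesis by (simp add: theta_coset_def theta_eq_swap)
qed

lemma dcoset_comp_assoc:
  assumes "a \<in> carrier B\<^sub>\<infinity>" "b \<in> carrier B\<^sub>\<infinity>" "c \<in> carrier B\<^sub>\<infinity>"
  shows "dcoset_comp \<alpha> \<gamma> \<delta>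
      (dcoset_comp \<alpha> \<beta> \<gamma> (double_coset \<alpha> a \<beta>) (double_coset \<beta> b \<gamma>)) (double_coset \<gamma> c \<delta>)
    = dcoset_comp \<alpha> \<beta> \<delta>
      (double_coset \<alpha> a \<beta>) (dcoset_comp \<beta> \<gamma> \<delta> (double_coset \<beta> b \<gamma>) (double_coset \<gamma> c \<delta>))"
proof -
  have "\<forall>\<^sub>F N in sequentially. a \<in> tail_centralizer (0 + N) \<and> b \<in> tail_centralizer (0 + N) \<and>
      c \<in> tail_centralizer (0 + N) \<and> \<alpha> \<le> N \<and> \<beta> \<le> N \<and> \<gamma> \<le> N \<and> \<delta> \<le> N"
    by (intro eventually_conj eventually_tail_centralizer assms eventually_ge_at_top)
  then obtain N where "a \<in> tail_centralizer (0 + N) \<and> b \<in> tail_centralizer (0 + N) \<and>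
      c \<in> tail_centralizer (0 + N) \<and> \<alpha> \<le> N \<and> \<beta> \<le> N \<and> \<gamma> \<le> N \<and> \<delta> \<le> N"
    using eventually_happens'[OF sequentially_bot] by blast
  then have N: "a \<in> tail_centralizer N" "b \<in> tail_centralizer N" "c \<in> tail_centralizer N"
    "\<alpha> \<le> N" "\<beta> \<le> N" "\<gamma> \<le> N" "\<delta> \<le> N" by auto
  \<comment> \<open>Both first swaps are to end their moving block at the same position N, so that a
    single factor \<open>swap N m n\<close> serves both bracketings.\<close>
  define n where "n = N - \<beta>"
  define m where "m = N - \<gamma>"
  have n: "\<beta> + n = N" and m: "\<gamma> + m = N" using N by (auto simp: n_def m_def)
  have large: "x \<in> tail_centralizer (\<gamma> + (m + n))" "x \<in> tail_centralizer (\<beta> + (n + m))"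
    if "x \<in> tail_centralizer N" for x
    using tail_centralizer_mono[OF that] n m by auto
  define p where "p = a \<cdot> swap \<beta> n n \<cdot> b"
  define q where "q = b \<cdot> swap \<gamma> m m \<cdot> c"
  \<comment> \<open>The swap inside p reaches up to \<beta> + 2n = N + n = \<gamma> + (m + n), so
    the next composition is taken at size m + n.\<close>
  have p: "p \<in> tail_centralizer (\<gamma> + (m + n))"
    unfolding p_def by (intro tail_centralizer_mult swap_centralizes large N) (use n m in simp)
  have q: "q \<in> tail_centralizer (\<beta> + (n + m))"
    unfolding q_def by (intro tail_centralizer_mult swap_centralizes large N) (use n m in simp)
  have c: "p \<in> carrier B\<^sub>\<infinity>" "q \<in> carrier B\<^sub>\<infinity>"
    using p q tail_centralizer_carrier by auto

  have "dcoset_comp \<alpha> \<gamma> \<delta>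
      (dcoset_comp \<alpha> \<beta> \<gamma> (double_coset \<alpha> a \<beta>) (double_coset \<beta> b \<gamma>)) (double_coset \<gamma> c \<delta>)
    = dcoset_comp \<alpha> \<gamma> \<delta> (double_coset \<alpha> p \<gamma>) (double_coset \<gamma> c \<delta>)"
    using N n by (simp add: dcoset_comp_eq[of a \<beta> n b] p_def)
  also have "\<dots> = double_coset \<alpha> (p \<cdot> swap \<gamma> (m + n) (m + n) \<cdot> c) \<delta>"
    using N m by (intro dcoset_comp_eq p large) auto
  \<comment> \<open>Only c and \<delta> constrain the moving block, and both are controlled by N =
    \<gamma> + m; the crossed block keeps size m + n because of p.\<close>
  also have "\<dots> = double_coset \<alpha> (p \<cdot> swap \<gamma> m (m + n) \<cdot> c) \<delta>"
    using N m c by (intro swap_coset_stable_left) auto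
  also have "p \<cdot> swap \<gamma> m (m + n) \<cdot> c = a \<cdot> swap \<beta> (n + m) n \<cdot> q"
  proof -
    have comm: "b \<cdot> swap N m n = swap N m n \<cdot> b"
      using N(2) swap_in_tail by (rule tail_commute)
    \<comment> \<open>\<open>swap_add_right\<close> exposes \<open>swap N m n\<close> next to b;
      once it has passed b, \<open>swap_add_left\<close> merges it into the first swap.\<close>
    have "p \<cdot> swap \<gamma> m (m + n) \<cdot> c
        = a \<cdot> swap \<beta> n n \<cdot> (b \<cdot> swap N m n) \<cdot> swap \<gamma> m m \<cdot> c"
      using assms by (simp add: p_def swap_add_right m BG.m_assoc)
    also have "\<dots> = a \<cdot> swap \<beta> (n + m) n \<cdot> q"
      unfolding comm using assms by (simp add: q_def swap_add_left n BG.m_assoc)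
    finally show ?thesis .
  qed
  \<comment> \<open>The crossed block is enlarged again, which a and \<alpha> permit since N =
    \<beta> + n; the equal sizes n + m are those of the composition with q.\<close>
  also have "double_coset \<alpha> (a \<cdot> swap \<beta> (n + m) n \<cdot> q) \<delta>
      = double_coset \<alpha> (a \<cdot> swap \<beta> (n + m) (n + m) \<cdot> q) \<delta>"
    using N n c by (intro swap_coset_stable_right[symmetric]) auto
  also have "\<dots> = dcoset_comp \<alpha> \<beta> \<delta> (double_coset \<alpha> a \<beta>) (double_coset \<beta> q \<delta>)"
    using N n by (intro dcoset_comp_eq[symmetric] q large) auto
  also have "double_coset \<beta> q \<delta>
      = dcoset_comp \<beta> \<gamma> \<delta> (double_coset \<beta> b \<gamma>) (double_coset \<gamma> c \<delta>)"
    using N m by (simp add: dcoset_comp_eq[of b \<gamma> m c] q_def)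
  finally show ?thesis .
qed

lemma dcoset_comp_eventually:
  assumes "g \<in> carrier B\<^sub>\<infinity>" "h \<in> carrier B\<^sub>\<infinity>"
  shows "dcoset_comp \<alpha> \<beta> \<gamma> (double_coset \<alpha> g \<beta>) (double_coset \<beta> h \<gamma>) \<in> double_cosets \<alpha> \<gamma>"
    and "\<lbrakk>p \<in> double_coset \<alpha> g \<beta>; q \<in> double_coset \<beta> h \<gamma>\<rbrakk> \<Longrightarrow>
      \<forall>\<^sub>F n in sequentially. theta_coset \<alpha> \<beta> \<gamma> p q n
        = dcoset_comp \<alpha> \<beta> \<gamma> (double_coset \<alpha> g \<beta>) (double_coset \<beta> h \<gamma>)"
proof -
  have "\<forall>\<^sub>F n in sequentially. g \<in> tail_centralizer (\<beta> + n) \<and> h \<in> tail_centralizer (\<beta> + n) \<and>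
      \<alpha> \<le> \<beta> + n \<and> \<gamma> \<le> \<beta> + n"
    by (intro eventually_conj eventually_tail_centralizer assms eventually_ge_add)
  then obtain n where n: "g \<in> tail_centralizer (\<beta> + n)" "h \<in> tail_centralizer (\<beta> + n)"
      "\<alpha> \<le> \<beta> + n" "\<gamma> \<le> \<beta> + n"
    using eventually_happens'[OF sequentially_bot] by blast
  show "dcoset_comp \<alpha> \<beta> \<gamma> (double_coset \<alpha> g \<beta>) (double_coset \<beta> h \<gamma>) \<in> double_cosets \<alpha> \<gamma>"
    using assms by (auto simp: dcoset_comp_eq[OF n] double_cosets_def)
  show "\<forall>\<^sub>F n in sequentially. theta_coset \<alpha> \<beta> \<gamma> p q n
      = dcoset_comp \<alpha> \<beta> \<gamma> (double_coset \<alpha> g \<beta>) (double_coset \<beta> h \<gamma>)"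
    if "p \<in> double_coset \<alpha> g \<beta>" "q \<in> double_coset \<beta> h \<gamma>"
    using theta_coset_eventually[OF n that]
    by (simp add: dcoset_comp_eq[OF n] theta_coset_def theta_eq_swap)
qed

theorem theorem1p5:
  shows
   "(\<forall>\<alpha> \<beta> \<gamma> :: nat. \<forall>P \<in> double_cosets \<alpha> \<beta>. \<forall>Q \<in> double_cosets \<beta> \<gamma>.
      (\<forall>p\<in>P. \<forall>q\<in>Q. \<exists>R. \<forall>\<^sub>F n in sequentially. theta_coset \<alpha> \<beta> \<gamma> p q n = R) \<and>
      (\<forall>p\<in>P. \<forall>q\<in>Q. \<forall>p'\<in>P. \<forall>q'\<in>Q. \<forall>\<^sub>F n in sequentially.
          theta_coset \<alpha> \<beta> \<gamma> p q n = theta_coset \<alpha> \<beta> \<gamma> p' q' n) \<and>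
      dcoset_comp \<alpha> \<beta> \<gamma> P Q \<in> double_cosets \<alpha> \<gamma> \<and>
      (\<forall>p\<in>P. \<forall>q\<in>Q. \<forall>\<^sub>F n in sequentially.
          theta_coset \<alpha> \<beta> \<gamma> p q n = dcoset_comp \<alpha> \<beta> \<gamma> P Q)) \<and>
    (\<forall>\<alpha> \<beta> \<gamma> \<delta> :: nat. \<forall>A \<in> double_cosets \<alpha> \<beta>. \<forall>B \<in> double_cosets \<beta> \<gamma>.
      \<forall>C \<in> double_cosets \<gamma> \<delta>.
        dcoset_comp \<alpha> \<gamma> \<delta> (dcoset_comp \<alpha> \<beta> \<gamma> A B) C =
        dcoset_comp \<alpha> \<beta> \<delta> A (dcoset_comp \<beta> \<gamma> \<delta> B C))"
proof (intro conjI allI ballI)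
  fix \<alpha> \<beta> \<gamma> P Q
  assume "P \<in> double_cosets \<alpha> \<beta>" "Q \<in> double_cosets \<beta> \<gamma>"
  then obtain g h where gh: "g \<in> carrier B\<^sub>\<infinity>" "h \<in> carrier B\<^sub>\<infinity>"
    and PQ: "P = double_coset \<alpha> g \<beta>" "Q = double_coset \<beta> h \<gamma>"
    by (auto simp: double_cosets_def)
  show "dcoset_comp \<alpha> \<beta> \<gamma> P Q \<in> double_cosets \<alpha> \<gamma>"
    unfolding PQ by (rule dcoset_comp_eventually(1)[OF gh])
  \<comment> \<open>A common limit for all representatives yields both the existence of the eventual
    value and its independence of the choice.\<close>
  have lim: "\<forall>\<^sub>F n in sequentially. theta_coset \<alpha> \<beta> \<gamma> p q n = dcoset_comp \<alpha> \<beta> \<gamma> P Q"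
    if "p \<in> P" "q \<in> Q" for p q
    using that unfolding PQ by (rule dcoset_comp_eventually(2)[OF gh])
  fix p q
  assume pq: "p \<in> P" "q \<in> Q"
  show "\<forall>\<^sub>F n in sequentially. theta_coset \<alpha> \<beta> \<gamma> p q n = dcoset_comp \<alpha> \<beta> \<gamma> P Q"
    using lim[OF pq] .
  then show "\<exists>R. \<forall>\<^sub>F n in sequentially. theta_coset \<alpha> \<beta> \<gamma> p q n = R" ..
  fix p' q'
  assume "p' \<in> P" "q' \<in> Q"
  with lim[OF pq] lim[of p' q']
  show "\<forall>\<^sub>F n in sequentially. theta_coset \<alpha> \<beta> \<gamma> p q n = theta_coset \<alpha> \<beta> \<gamma> p' q' n"
    by (auto elim: eventually_elim2)
next
  fix \<alpha> \<beta> \<gamma> \<delta> A B C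
  assume "A \<in> double_cosets \<alpha> \<beta>" "B \<in> double_cosets \<beta> \<gamma>" "C \<in> double_cosets \<gamma> \<delta>"
  then show "dcoset_comp \<alpha> \<gamma> \<delta> (dcoset_comp \<alpha> \<beta> \<gamma> A B) C =
      dcoset_comp \<alpha> \<beta> \<delta> A (dcoset_comp \<beta> \<gamma> \<delta> B C)"
    by (auto simp: double_cosets_def dcoset_comp_assoc)
qed

end
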